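(* Suppose that $\sum_{n=0}^\infty a_n^{-1}<\infty$, that $\beta_n\to\beta_\infty$ as $n\to\infty$ with $|\beta_\infty|<1$, that $\sum_n |k_n-1|<\infty$, and that $\sum_n|\beta_{n+1}-\beta_n|<\infty$. Then for every $z\in\mathbb C$ all solutions of the Jacobi equation $a_{n-1}F_{n-1}+b_nF_n+a_nF_{n+1}=zF_n$, $n\in\mathbb Z_+$, belong to $\ell^2(\mathbb Z_+)$, and hence the minimal Jacobi operator $J_0$ has deficiency indices $(1,1)$.
   Context: $\mathbb Z_+=\{0,1,2,\dots\}$. The coefficients satisfy $a_n>0$, $b_n\in\mathbb R$ for $n\in\mathbb Z_+$, and by convention $a_{-1}=1/2$. Notation: $$\beta_n=-\frac{b_n}{2\sqrt{a_{n-1}a_n}},\qquad k_n=\frac{a_n}{\sqrt{a_{n-1}a_{n+1}}}.$$ Solutions of the Jacobi equation are sequences $F=(F_n)_{n\ge-1}$. The minimal Jacobi operator $J_0$ acts in $\ell^2(\mathbb Z_+)$ with domain the set of sequences with finitely many nonzero components, by $(J_0u)_0=b_0u_0+a_0u_1$ and $(J_0u)_n=a_{n-1}u_{n-1}+b_nu_n+a_nu_{n+1}$ for $n\ge1$. It is symmetric. *)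

theory Defs
  imports Complex_Main "HOL-Library.Function_Algebras"
begin

section \<open>The Hilbert space of square-summable sequences and deficiency indices\<close>

definition ell2 :: "(nat \<Rightarrow> complex) set" where
  "ell2 = {u. summable (\<lambda>n. (norm (u n))\<^sup>2)}"

definition ell2_inner :: "(nat \<Rightarrow> complex) \<Rightarrow> (nat \<Rightarrow> complex) \<Rightarrow> complex" where
  "ell2_inner u v = (\<Sum>n. u n * cnj (v n))"

definition seq_scale :: "complex \<Rightarrow> (nat \<Rightarrow> complex) \<Rightarrow> (nat \<Rightarrow> complex)" where
  "seq_scale c u = (\<lambda>n. c * u n)"

lemma vector_space_seq_scale: "vector_space seq_scale"
  by unfold_locales (auto simp: seq_scale_def fun_eq_iff algebra_simps)

text \<open>
  A (possibly unbounded) operator in \<open>\<ell>\<^sup>2\<close> is represented by its graph, so that its domain is the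
  \<^const>\<open>Domain\<close> of the relation. For a densely defined operator \<open>T\<close>, the relation
  \<open>ell2_adjoint T\<close> is single-valued and is the graph of the Hilbert space adjoint.
\<close>

type_synonym ell2_operator = "((nat \<Rightarrow> complex) \<times> (nat \<Rightarrow> complex)) set"

definition ell2_adjoint :: "ell2_operator \<Rightarrow> ell2_operator" where
  "ell2_adjoint T =
    {(v, w). v \<in> ell2 \<and> w \<in> ell2 \<and> (\<forall>(u, Tu)\<in>T. ell2_inner Tu v = ell2_inner u w)}"

definition adjoint_eigenspace :: "ell2_operator \<Rightarrow> complex \<Rightarrow> (nat \<Rightarrow> complex) set" where
  "adjoint_eigenspace T z = {v. (v, seq_scale z v) \<in> ell2_adjoint T}"

text \<open>
  The dimensions of the kernels of \<open>T\<^sup>* - \<i>\<close> and \<open>T\<^sup>* + \<i>\<close>, as complex vector spaces. As usual for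
  \<^const>\<open>vector_space.dim\<close>, a value 0 does not distinguish the trivial space from an
  infinite-dimensional one; positive values are genuine finite dimensions.
\<close>

definition deficiency_indices :: "ell2_operator \<Rightarrow> nat \<times> nat" where
  "deficiency_indices T =
    (vector_space.dim seq_scale (adjoint_eigenspace T \<i>),
     vector_space.dim seq_scale (adjoint_eigenspace T (- \<i>)))"

section \<open>Jacobi operators\<close>

text \<open>The off-diagonal coefficients, extended to the index -1 by the convention \<open>a\<^sub>-\<^sub>1 = 1/2\<close>.
  Only indices \<open>n \<ge> -1\<close> are ever used.\<close>

definition jacobi_a :: "(nat \<Rightarrow> real) \<Rightarrow> int \<Rightarrow> real" where
  "jacobi_a a n = (if n < 0 then 1 / 2 else a (nat n))"

definition jacobi_beta :: "(nat \<Rightarrow> real) \<Rightarrow> (nat \<Rightarrow> real) \<Rightarrow> nat \<Rightarrow> real" where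
  "jacobi_beta a b n = - b n / (2 * sqrt (jacobi_a a (int n - 1) * jacobi_a a (int n)))"

definition jacobi_k :: "(nat \<Rightarrow> real) \<Rightarrow> nat \<Rightarrow> real" where
  "jacobi_k a n = jacobi_a a (int n) / sqrt (jacobi_a a (int n - 1) * jacobi_a a (int n + 1))"

text \<open>Sequences \<open>(F\<^sub>n)\<close> with \<open>n \<ge> -1\<close> are functions on the integers; their values below -1 are
  irrelevant.\<close>

definition jacobi_solution ::
    "(nat \<Rightarrow> real) \<Rightarrow> (nat \<Rightarrow> real) \<Rightarrow> complex \<Rightarrow> (int \<Rightarrow> complex) \<Rightarrow> bool" where
  "jacobi_solution a b z F \<longleftrightarrow>
    (\<forall>n::nat. of_real (jacobi_a a (int n - 1)) * F (int n - 1) + of_real (b n) * F (int n)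
      + of_real (jacobi_a a (int n)) * F (int n + 1) = z * F (int n))"

definition jacobi_matrix ::
    "(nat \<Rightarrow> real) \<Rightarrow> (nat \<Rightarrow> real) \<Rightarrow> (nat \<Rightarrow> complex) \<Rightarrow> nat \<Rightarrow> complex" where
  "jacobi_matrix a b u n =
    (if n = 0 then of_real (b 0) * u 0 + of_real (a 0) * u 1
     else of_real (a (n - 1)) * u (n - 1) + of_real (b n) * u n + of_real (a n) * u (n + 1))"

definition minimal_jacobi :: "(nat \<Rightarrow> real) \<Rightarrow> (nat \<Rightarrow> real) \<Rightarrow> ell2_operator" where
  "minimal_jacobi a b = {(u, jacobi_matrix a b u) | u. finite {n. u n \<noteq> 0}}"

end

theory Submission
  imports Defs
begin

text \<open>
  Put \<open>x\<^sub>n = sqrt a\<^sub>n * F\<^sub>n\<^sub>+\<^sub>1\<close>. The Jacobi equation becomes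
  \<open>x\<^sub>n\<^sub>+\<^sub>2 = (2 \<beta>\<^sub>n\<^sub>+\<^sub>2 + \<epsilon>\<^sub>n) x\<^sub>n\<^sub>+\<^sub>1 - k\<^sub>n\<^sub>+\<^sub>1 x\<^sub>n\<close> with \<open>\<epsilon>\<close> and \<open>k - 1\<close> summable. The quadratic form
  \<open>\<bar>x\<^sub>n\<bar>\<^sup>2 + \<bar>x\<^sub>n\<^sub>+\<^sub>1\<bar>\<^sup>2 - 2 \<beta> Re (x\<^sub>n\<^sub>+\<^sub>1 cnj x\<^sub>n)\<close> is conserved by the unperturbed equation with constant
  \<open>\<beta>\<close>, and is positive definite when \<open>\<bar>\<beta>\<bar> < 1\<close>; a discrete Gronwall argument therefore bounds \<open>x\<close>,
  so \<open>\<bar>F\<^sub>n\<^sub>+\<^sub>1\<bar>\<^sup>2 = O(1 / a\<^sub>n)\<close> is summable. The deficiency spaces consist of all solutions with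
  \<open>F\<^sub>-\<^sub>1 = 0\<close>, which are the multiples of a single one.
\<close>

section \<open>Energy estimates and boundedness for perturbed recurrences\<close>

lemma discrete_gronwall:
  fixes Q \<delta> :: "nat \<Rightarrow> real"
  assumes step: "\<And>n. n \<ge> N \<Longrightarrow> Q (Suc n) \<le> (1 + \<delta> n) * Q n"
    and Q_nonneg: "\<And>n. n \<ge> N \<Longrightarrow> 0 \<le> Q n"
    and \<delta>_nonneg: "\<And>n. 0 \<le> \<delta> n"
    and "summable \<delta>" and "n \<ge> N"
  shows "Q n \<le> exp (suminf \<delta>) * Q N"
proof -
  \<comment> \<open>The sum starts at 0 although the steps start at \<open>N\<close>: the extra
    terms are nonnegative and only enlarge the bound, and the partial sum is then dominated by
    \<open>suminf \<delta>\<close>.\<close>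
  have partial: "Q n \<le> exp (\<Sum>i<n. \<delta> i) * Q N"
    using \<open>n \<ge> N\<close>
  proof (induction n rule: dec_induct)
    case base
    have "1 \<le> exp (\<Sum>i<N. \<delta> i)"
      by (simp add: sum_nonneg \<delta>_nonneg)
    then show ?case
      using mult_right_mono[of 1 "exp (\<Sum>i<N. \<delta> i)" "Q N"] Q_nonneg[of N] by simp
  next
    case (step n)
    have "Q (Suc n) \<le> (1 + \<delta> n) * Q n"
      using assms(1) step by simp
    also have "\<dots> \<le> exp (\<delta> n) * (exp (\<Sum>i<n. \<delta> i) * Q N)"
      using step Q_nonneg[of n] \<delta>_nonneg[of n] by (intro mult_mono) (auto simp: exp_ge_add_one_self)
    also have "\<dots> = exp (\<Sum>i<Suc n. \<delta> i) * Q N"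
      by (simp add: exp_add)
    finally show ?case .
  qed
  also have "\<dots> \<le> exp (suminf \<delta>) * Q N"
    using sum_le_suminf[OF \<open>summable \<delta>\<close>, of "{..<n}"] \<delta>_nonneg Q_nonneg[of N]
    by (intro mult_right_mono) auto
  finally show ?thesis .
qed

text \<open>Since \<open>w + x = 2\<beta>y + r\<close>, expanding |w|^2 - |x|^2 = Re ((w + x) * cnj
  (w - x)) produces the two cross terms with coefficient \<beta>, plus a remainder linear in
  \<open>r\<close>. For \<open>r = 0\<close> and \<open>\<beta>' = \<beta>\<close> this is exact
  conservation of the energy.\<close>

lemma energy_difference:
  fixes x y w r :: complex and \<beta> \<beta>' :: real
  assumes "w = 2 * of_real \<beta> * y - x + r"
  shows "((norm y)\<^sup>2 + (norm w)\<^sup>2 - 2 * \<beta>' * Re (w * cnj y))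
         - ((norm x)\<^sup>2 + (norm y)\<^sup>2 - 2 * \<beta> * Re (y * cnj x))
       = Re (r * cnj (w - x)) - 2 * (\<beta>' - \<beta>) * Re (w * cnj y)"
proof -
  have r: "r = w + x - 2 * of_real \<beta> * y"
    using assms by simp
  show ?thesis
    unfolding r cmod_power2 by (simp add: power2_eq_square algebra_simps)
qed

text \<open>The cross term is absorbed by 2 |x| |y| \<le> |x|^2 + |y|^2. The constant
  \<open>1 - q\<close> is the same for all \<beta> in [-q, q], so one bound serves a whole tail of
  varying \<beta>.\<close>

lemma energy_coercive:
  fixes x y :: complex and \<beta> q :: real
  assumes "\<bar>\<beta>\<bar> \<le> q"
  shows "(1 - q) * ((norm x)\<^sup>2 + (norm y)\<^sup>2)
      \<le> (norm x)\<^sup>2 + (norm y)\<^sup>2 - 2 * \<beta> * Re (y * cnj x)"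
proof -
  have "2 * \<beta> * Re (y * cnj x) \<le> \<bar>\<beta>\<bar> * (2 * \<bar>Re (y * cnj x)\<bar>)"
    using abs_ge_self[of "2 * \<beta> * Re (y * cnj x)"] by (simp add: abs_mult)
  also have "\<dots> \<le> q * ((norm x)\<^sup>2 + (norm y)\<^sup>2)"
  proof (rule mult_mono)
    have "2 * \<bar>Re (y * cnj x)\<bar> \<le> 2 * norm y * norm x"
      using abs_Re_le_cmod[of "y * cnj x"] by (simp add: norm_mult)
    also have "\<dots> \<le> (norm x)\<^sup>2 + (norm y)\<^sup>2"
      using sum_squares_bound[of "norm y" "norm x"] by simp
    finally show "2 * \<bar>Re (y * cnj x)\<bar> \<le> (norm x)\<^sup>2 + (norm y)\<^sup>2" .
  qed (use assms in auto)
  finally show ?thesis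
    by (simp add: algebra_simps)
qed

text \<open>All error terms of \<open>energy_difference\<close> are at most a constant times
  \<delta> t^2 with t = |x| + |y|, and coercivity bounds t^2 by a multiple of \<open>Q\<close>. The
  a priori bound \<open>M\<close> keeps |w| within a fixed multiple of t, so the growth factor is 1
  plus a fixed constant times \<delta>.\<close>

lemma energy_step:
  fixes x y w \<epsilon> \<kappa> :: complex and \<beta> \<beta>' q M :: real
  assumes w: "w = (2 * of_real \<beta> + \<epsilon>) * y - (1 + \<kappa>) * x"
    and "\<bar>\<beta>\<bar> \<le> q" "q < 1" "norm \<epsilon> \<le> M" "norm \<kappa> \<le> M"
  defines "Q \<equiv> (norm x)\<^sup>2 + (norm y)\<^sup>2 - 2 * \<beta> * Re (y * cnj x)"
    and "\<delta> \<equiv> norm \<epsilon> + norm \<kappa> + \<bar>\<beta>' - \<beta>\<bar>"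
  shows "(norm y)\<^sup>2 + (norm w)\<^sup>2 - 2 * \<beta>' * Re (w * cnj y)
      \<le> (1 + 4 * (M + 3) / (1 - q) * \<delta>) * Q"
proof -
  define t where "t = norm x + norm y"
  define r where "r = \<epsilon> * y - \<kappa> * x"
  have M: "0 \<le> M" using \<open>norm \<epsilon> \<le> M\<close> norm_ge_zero order_trans by blast
  have t: "0 \<le> t" "norm x \<le> t" "norm y \<le> t" by (auto simp: t_def)
  have w_bound: "norm w \<le> (M + 2) * t"
  proof -
    have "norm (2 * complex_of_real \<beta> + \<epsilon>) \<le> M + 2"
      using norm_triangle_ineq[of "2 * complex_of_real \<beta>" \<epsilon>] assms(2-4) by (simp add: norm_mult)
    moreover have "norm (1 + \<kappa>) \<le> M + 2"
      using norm_triangle_ineq[of 1 \<kappa>] assms(5) by simp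
    ultimately have "norm w \<le> (M + 2) * norm y + (M + 2) * norm x"
      unfolding w using norm_triangle_ineq4 order_trans add_mono mult_right_mono norm_ge_zero
      by (smt (verit) norm_mult)
    then show ?thesis by (simp add: t_def algebra_simps)
  qed
  have r_bound: "norm r \<le> (norm \<epsilon> + norm \<kappa>) * t"
  proof -
    have "norm r \<le> norm \<epsilon> * norm y + norm \<kappa> * norm x"
      unfolding r_def using norm_triangle_ineq4[of "\<epsilon> * y" "\<kappa> * x"] by (simp add: norm_mult)
    also have "\<dots> \<le> norm \<epsilon> * t + norm \<kappa> * t"
      using t by (intro add_mono mult_left_mono) auto
    finally show ?thesis by (simp add: algebra_simps)
  qed
  have "norm (w - x) \<le> (M + 3) * t"
    using norm_triangle_ineq4[of w x] w_bound t by (simp add: algebra_simps)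
  then have "norm (r * cnj (w - x)) \<le> ((norm \<epsilon> + norm \<kappa>) * t) * ((M + 3) * t)"
    unfolding norm_mult complex_mod_cnj using r_bound t by (intro mult_mono) auto
  then have 1: "Re (r * cnj (w - x)) \<le> ((norm \<epsilon> + norm \<kappa>) * t) * ((M + 3) * t)"
    using complex_Re_le_cmod order_trans by blast
  have "norm (w * cnj y) \<le> ((M + 2) * t) * t"
    unfolding norm_mult complex_mod_cnj using w_bound t M by (intro mult_mono) auto
  also have "\<dots> \<le> ((M + 3) * t) * t"
    using t by (intro mult_right_mono) auto
  finally have "\<bar>Re (w * cnj y)\<bar> \<le> (M + 3) * t * t"
    using abs_Re_le_cmod order_trans by blast
  then have "2 * \<bar>\<beta>' - \<beta>\<bar> * \<bar>Re (w * cnj y)\<bar> \<le> 2 * \<bar>\<beta>' - \<beta>\<bar> * ((M + 3) * t * t)"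
    by (intro mult_left_mono) auto
  moreover have "- (2 * (\<beta>' - \<beta>) * Re (w * cnj y)) \<le> 2 * \<bar>\<beta>' - \<beta>\<bar> * \<bar>Re (w * cnj y)\<bar>"
    using abs_ge_minus_self[of "2 * (\<beta>' - \<beta>) * Re (w * cnj y)"]
    by (simp only: abs_mult abs_numeral)
  ultimately have 2: "- (2 * (\<beta>' - \<beta>) * Re (w * cnj y)) \<le> 2 * \<bar>\<beta>' - \<beta>\<bar> * ((M + 3) * t * t)"
    by simp
  have "w = 2 * of_real \<beta> * y - x + r"
    unfolding w r_def by (simp add: algebra_simps)
  from energy_difference[OF this, of \<beta>']
  have "(norm y)\<^sup>2 + (norm w)\<^sup>2 - 2 * \<beta>' * Re (w * cnj y) - Q
      \<le> (norm \<epsilon> + norm \<kappa>) * t * ((M + 3) * t) + 2 * \<bar>\<beta>' - \<beta>\<bar> * ((M + 3) * t * t)"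
    unfolding Q_def using 1 2 by simp
  also have "\<dots> = ((M + 3) * t\<^sup>2) * (norm \<epsilon> + norm \<kappa> + 2 * \<bar>\<beta>' - \<beta>\<bar>)"
    by (simp add: power2_eq_square algebra_simps)
  also have "\<dots> \<le> ((M + 3) * t\<^sup>2) * (2 * \<delta>)"
    unfolding \<delta>_def using M by (intro mult_left_mono) auto
  also have "\<dots> = 2 * (M + 3) * \<delta> * t\<^sup>2"
    by simp
  \<comment> \<open>Here t^2 \<le> 2 (|x|^2 + |y|^2) \<le> 2 Q / (1 - q); with the factor 2 already
    in front this is the source of \<open>4 / (1 - q)\<close>.\<close>
  also have "\<dots> \<le> 2 * (M + 3) * \<delta> * (2 * (Q / (1 - q)))"
  proof (rule mult_left_mono)
    have "(1 - q) * ((norm x)\<^sup>2 + (norm y)\<^sup>2) \<le> Q"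
      unfolding Q_def by (rule energy_coercive) fact
    then have "(norm x)\<^sup>2 + (norm y)\<^sup>2 \<le> Q / (1 - q)"
      using \<open>q < 1\<close> by (simp add: pos_le_divide_eq mult.commute)
    moreover have "t\<^sup>2 \<le> 2 * ((norm x)\<^sup>2 + (norm y)\<^sup>2)"
      unfolding t_def using sum_squares_bound[of "norm x" "norm y"]
      by (simp add: power2_sum)
    ultimately show "t\<^sup>2 \<le> 2 * (Q / (1 - q))" by simp
  qed (use M in \<open>simp add: \<delta>_def\<close>)
  finally show ?thesis
    by (simp add: algebra_simps add_divide_distrib)
qed

text \<open>From some \<open>N\<close> on, |\<beta>| stays below a fixed \<open>q < 1\<close>, so
  the energy is uniformly coercive there. Its growth factors \<open>1 + \<delta> n\<close> have
  summable \<delta>, hence Gronwall bounds the energy, and coercivity carries the bound over to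
  \<open>x\<close>.\<close>

lemma Bseq_perturbed_recurrence:
  fixes x \<epsilon> \<kappa> :: "nat \<Rightarrow> complex" and \<beta> :: "nat \<Rightarrow> real"
  assumes rec: "\<And>n. x (Suc (Suc n)) = (2 * of_real (\<beta> n) + \<epsilon> n) * x (Suc n) - (1 + \<kappa> n) * x n"
    and "\<beta> \<longlonglongrightarrow> \<beta>_inf" "\<bar>\<beta>_inf\<bar> < 1"
    and sum\<beta>: "summable (\<lambda>n. \<bar>\<beta> (Suc n) - \<beta> n\<bar>)"
    and sum\<epsilon>: "summable (\<lambda>n. norm (\<epsilon> n))" and sum\<kappa>: "summable (\<lambda>n. norm (\<kappa> n))"
  shows "Bseq x"
proof -
  obtain q where q: "\<bar>\<beta>_inf\<bar> < q" "q < 1"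
    using dense[OF \<open>\<bar>\<beta>_inf\<bar> < 1\<close>] by blast
  have "eventually (\<lambda>n. \<bar>\<beta> n\<bar> < q) sequentially"
    using order_tendstoD(2)[OF tendsto_rabs[OF \<open>\<beta> \<longlonglongrightarrow> \<beta>_inf\<close>] q(1)] .
  then obtain N where N: "\<And>n. n \<ge> N \<Longrightarrow> \<bar>\<beta> n\<bar> \<le> q"
    unfolding eventually_sequentially by (meson less_imp_le)
  \<comment> \<open>A term of a convergent nonnegative series is at most its sum; adding the two
    sums gives one bound for both perturbations.\<close>
  define M where "M = suminf (\<lambda>n. norm (\<epsilon> n)) + suminf (\<lambda>n. norm (\<kappa> n))"
  have "norm (\<epsilon> n) \<le> suminf (\<lambda>n. norm (\<epsilon> n))" "norm (\<kappa> n) \<le> suminf (\<lambda>n. norm (\<kappa> n))" for n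
    using sum_le_suminf[OF sum\<epsilon>, of "{n}"] sum_le_suminf[OF sum\<kappa>, of "{n}"] by auto
  then have M: "norm (\<epsilon> n) \<le> M" "norm (\<kappa> n) \<le> M" for n
    unfolding M_def using suminf_nonneg[OF sum\<epsilon>] suminf_nonneg[OF sum\<kappa>]
    by (simp_all add: add_increasing add_increasing2)
  have "0 \<le> M" using M(1) norm_ge_zero order_trans by blast
  define Q where
    "Q n = (norm (x n))\<^sup>2 + (norm (x (Suc n)))\<^sup>2 - 2 * \<beta> n * Re (x (Suc n) * cnj (x n))" for n
  define \<delta> where
    "\<delta> n = 4 * (M + 3) / (1 - q) * (norm (\<epsilon> n) + norm (\<kappa> n) + \<bar>\<beta> (Suc n) - \<beta> n\<bar>)" for n
  have step: "Q (Suc n) \<le> (1 + \<delta> n) * Q n" if "n \<ge> N" for n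
    unfolding Q_def \<delta>_def using energy_step[OF rec[of n] N[OF that] q(2) M[of n], of "\<beta> (Suc n)"] .
  have coercive: "(1 - q) * ((norm (x n))\<^sup>2 + (norm (x (Suc n)))\<^sup>2) \<le> Q n" if "n \<ge> N" for n
    unfolding Q_def by (rule energy_coercive) (rule N[OF that])
  have Q_nonneg: "0 \<le> Q n" if "n \<ge> N" for n
    using coercive[OF that] q by (smt (verit) mult_nonneg_nonneg zero_le_power2)
  have \<delta>_nonneg: "0 \<le> \<delta> n" for n
    unfolding \<delta>_def using \<open>0 \<le> M\<close> q by simp
  have "summable \<delta>"
    unfolding \<delta>_def by (intro summable_mult summable_add sum\<epsilon> sum\<kappa> sum\<beta>)
  define B where "B = exp (suminf \<delta>) * Q N / (1 - q)"
  have "norm (x n) \<le> sqrt B" if "n \<ge> N" for n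
  proof (rule real_le_rsqrt)
    have "(1 - q) * (norm (x n))\<^sup>2 \<le> Q n"
      using coercive[OF that] q by (smt (verit) mult_left_mono zero_le_power2)
    also have "\<dots> \<le> exp (suminf \<delta>) * Q N"
      using discrete_gronwall[OF step Q_nonneg \<delta>_nonneg \<open>summable \<delta>\<close> that] by blast
    finally show "(norm (x n))\<^sup>2 \<le> B"
      unfolding B_def using q by (simp add: pos_le_divide_eq mult.commute)
  qed
  then have "eventually (\<lambda>n. norm (x n) \<le> sqrt B) sequentially"
    unfolding eventually_sequentially by blast
  then show ?thesis
    by (rule BfunI)
qed

section \<open>Square-summability of all solutions\<close>

lemma jacobi_solution_ell2:
  fixes a b :: "nat \<Rightarrow> real"
  assumes pos: "\<And>n. a n > 0"
    and sum_a: "summable (\<lambda>n. inverse (a n))"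
    and lim: "jacobi_beta a b \<longlonglongrightarrow> \<beta>_inf" "\<bar>\<beta>_inf\<bar> < 1"
    and sum_k: "summable (\<lambda>n. \<bar>jacobi_k a n - 1\<bar>)"
    and sum_\<beta>: "summable (\<lambda>n. \<bar>jacobi_beta a b (n + 1) - jacobi_beta a b n\<bar>)"
    and F: "jacobi_solution a b z F"
  shows "(\<lambda>n. F (int n)) \<in> ell2"
proof -
  define x where "x n = of_real (sqrt (a n)) * F (int (Suc n))" for n
  \<comment> \<open>The recurrence for \<open>x\<close> at \<open>n + 2\<close> is the Jacobi
    equation at index \<open>n + 2\<close> divided by \<open>sqrt (a (n + 2))\<close>. It involves
    \<beta> at \<open>n + 2\<close> and k at \<open>n + 1\<close>, so every index of
    \<open>jacobi_a\<close> is nonnegative and it reduces to \<open>a\<close>.\<close>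
  define \<beta> where "\<beta> n = jacobi_beta a b (n + 2)" for n
  define \<epsilon> where "\<epsilon> n = z / of_real (sqrt (a (n + 1) * a (n + 2)))" for n
  define \<kappa> where "\<kappa> n = complex_of_real (jacobi_k a (n + 1) - 1)" for n
  have rec: "x (Suc (Suc n)) = (2 * of_real (\<beta> n) + \<epsilon> n) * x (Suc n) - (1 + \<kappa> n) * x n" for n
  proof -
    define s0 s1 s2 where "s0 = complex_of_real (sqrt (a n))"
      and "s1 = complex_of_real (sqrt (a (Suc n)))"
      and "s2 = complex_of_real (sqrt (a (Suc (Suc n))))"
    note s_def = s0_def s1_def s2_def
    have nz: "s0 \<noteq> 0" "s1 \<noteq> 0" "s2 \<noteq> 0"
      unfolding s_def using pos by (simp_all add: less_imp_neq[symmetric])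
    have sq: "complex_of_real (a (Suc n)) = s1 * s1" "complex_of_real (a (Suc (Suc n))) = s2 * s2"
      unfolding s_def of_real_mult[symmetric] using pos by (simp_all add: less_imp_le)
    have eps: "\<epsilon> n = z / (s1 * s2)"
      unfolding \<epsilon>_def s_def by (simp add: real_sqrt_mult)
    have beta: "2 * of_real (\<beta> n) = - of_real (b (Suc (Suc n))) / (s1 * s2)"
      unfolding \<beta>_def s_def jacobi_beta_def jacobi_a_def
      by (simp add: real_sqrt_mult nat_add_distrib nat_diff_distrib')
    have kap: "1 + \<kappa> n = s1 * s1 / (s0 * s2)"
    proof -
      have "jacobi_k a (n + 1) = a (Suc n) / (sqrt (a n) * sqrt (a (Suc (Suc n))))"
        unfolding jacobi_k_def jacobi_a_def by (simp add: real_sqrt_mult nat_add_distrib)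
      then show ?thesis unfolding \<kappa>_def by (simp add: sq(1) s0_def s2_def)
    qed
    have "s1 * s1 * F (int (Suc n)) + of_real (b (Suc (Suc n))) * F (int (Suc (Suc n)))
        + s2 * s2 * F (int (Suc (Suc (Suc n)))) = z * F (int (Suc (Suc n)))"
      using F[unfolded jacobi_solution_def, rule_format, of "Suc (Suc n)"]
      by (simp add: jacobi_a_def nat_add_distrib sq[symmetric] add.commute)
    then have eq: "s2 * s2 * F (int (Suc (Suc (Suc n))))
      = (z - of_real (b (Suc (Suc n)))) * F (int (Suc (Suc n))) - s1 * s1 * F (int (Suc n))"
      by (simp add: algebra_simps)
    have "s2 * x (Suc (Suc n)) = s2 * s2 * F (int (Suc (Suc (Suc n))))"
      unfolding x_def s_def by simp
    also have "\<dots> = s2 * ((2 * of_real (\<beta> n) + \<epsilon> n) * x (Suc n) - (1 + \<kappa> n) * x n)"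
      unfolding eq eps beta kap x_def s_def[symmetric] using nz by (simp add: field_simps)
    finally show ?thesis using nz by simp
  qed
  have "Bseq x"
  proof (rule Bseq_perturbed_recurrence[of x \<beta> \<epsilon> \<kappa>, OF rec _ lim(2)])
    show "\<beta> \<longlonglongrightarrow> \<beta>_inf"
      unfolding \<beta>_def by (rule LIMSEQ_ignore_initial_segment[OF lim(1)])
    show "summable (\<lambda>n. \<bar>\<beta> (Suc n) - \<beta> n\<bar>)"
      unfolding \<beta>_def using summable_ignore_initial_segment[OF sum_\<beta>, of 2] by simp
    show "summable (\<lambda>n. norm (\<kappa> n))"
      unfolding \<kappa>_def norm_of_real by (rule summable_ignore_initial_segment[OF sum_k])
    show "summable (\<lambda>n. norm (\<epsilon> n))"
    proof (rule summable_comparison_test')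
      show "summable (\<lambda>n. norm z * (inverse (a (n + 1)) + inverse (a (n + 2))))"
        by (intro summable_mult summable_add summable_ignore_initial_segment sum_a)
      fix n
      \<comment> \<open>The product 1 / sqrt (a_(n+1) a_(n+2)) is controlled by the
        arithmetic-geometric mean inequality, which makes \<epsilon> summable for each fixed
        \<open>z\<close>.\<close>
      define u v where "u = inverse (sqrt (a (n + 1)))" and "v = inverse (sqrt (a (n + 2)))"
      have "2 * u * v \<le> inverse (a (n + 1)) + inverse (a (n + 2))"
        using sum_squares_bound[of u v] pos unfolding u_def v_def
        by (simp add: less_imp_le power_inverse)
      moreover have "0 \<le> u * v"
        unfolding u_def v_def using pos by (simp add: less_imp_le)
      ultimately have "u * v \<le> inverse (a (n + 1)) + inverse (a (n + 2))"
        by linarith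
      moreover have "norm (\<epsilon> n) = norm z * (u * v)"
        unfolding \<epsilon>_def u_def v_def using pos[of "Suc n"] pos[of "Suc (Suc n)"]
        by (simp add: norm_divide real_sqrt_mult norm_mult divide_simps)
      ultimately show "norm (norm (\<epsilon> n))
          \<le> norm z * (inverse (a (n + 1)) + inverse (a (n + 2)))"
        using \<open>0 \<le> u * v\<close> by (simp add: mult_left_mono abs_mult)
    qed
  qed
  then obtain B where B: "\<And>n. norm (x n) \<le> B"
    unfolding Bseq_def by blast
  have "summable (\<lambda>n. (norm (F (int (Suc n))))\<^sup>2)"
  proof (rule summable_comparison_test')
    show "summable (\<lambda>n. B\<^sup>2 * inverse (a n))"
      by (intro summable_mult sum_a)
    fix n
    have "a n * (norm (F (int (Suc n))))\<^sup>2 = (norm (x n))\<^sup>2"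
      unfolding x_def using pos[of n] by (simp add: norm_mult power_mult_distrib)
    also have "\<dots> \<le> B\<^sup>2"
      using B by (simp add: power_mono)
    finally show "norm ((norm (F (int (Suc n))))\<^sup>2) \<le> B\<^sup>2 * inverse (a n)"
      using pos[of n] by (simp add: field_simps)
  qed
  then show ?thesis
    unfolding ell2_def using summable_Suc_iff[of "\<lambda>n. (norm (F (int n)))\<^sup>2"] by simp
qed

section \<open>Green's formula and the adjoint of the minimal operator\<close>

text \<open>Discrete Green's formula: the symmetric off-diagonal contributions cancel in pairs,
  leaving a Wronskian at the upper end. The lower end leaves nothing because row 0 has no left
  neighbour. The pairing is bilinear; conjugation enters only when it is applied.\<close>

lemma jacobi_matrix_lagrange:
  fixes u v :: "nat \<Rightarrow> complex"
  shows "(\<Sum>n<Suc N. jacobi_matrix a b u n * v n)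
       = (\<Sum>n<Suc N. u n * jacobi_matrix a b v n)
         + of_real (a N) * (u (Suc N) * v N - u N * v (Suc N))"
  by (induction N) (simp_all add: jacobi_matrix_def algebra_simps)

lemma cnj_jacobi_matrix: "cnj (jacobi_matrix a b v n) = jacobi_matrix a b (\<lambda>i. cnj (v i)) n"
  by (simp add: jacobi_matrix_def)

lemma ell2_inner_finite_support:
  assumes "\<And>n. n \<ge> N \<Longrightarrow> u n = 0"
  shows "ell2_inner u v = (\<Sum>n<N. u n * cnj (v n))"
  unfolding ell2_inner_def using assms by (intro suminf_finite) auto

text \<open>Row 0 of the matrix is the Jacobi equation with F_(-1) = 0. Formal eigenvectors thus
  become solutions, to which \<open>jacobi_solution_ell2\<close> applies.\<close>

lemma jacobi_solution_extension:
  assumes "\<And>n. jacobi_matrix a b v n = z * v n"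
  shows "jacobi_solution a b z (\<lambda>i. if i < 0 then 0 else v (nat i))"
  unfolding jacobi_solution_def
proof
  fix n
  show "of_real (jacobi_a a (int n - 1)) * (if int n - 1 < 0 then 0 else v (nat (int n - 1)))
      + of_real (b n) * (if int n < 0 then 0 else v (nat (int n)))
      + of_real (jacobi_a a (int n)) * (if int n + 1 < 0 then 0 else v (nat (int n + 1)))
      = z * (if int n < 0 then 0 else v (nat (int n)))"
    using assms[of n]
    by (cases n) (simp_all add: jacobi_matrix_def jacobi_a_def nat_add_distrib)
qed

lemma seq_scale_ell2: "v \<in> ell2 \<Longrightarrow> seq_scale c v \<in> ell2"
  unfolding ell2_def seq_scale_def by (simp add: norm_mult power_mult_distrib summable_mult)

text \<open>The adjoint acts by the same matrix on its maximal domain in \<open>ell2\<close>: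
  testing against unit vectors yields each row of the eigenvalue equation, and conversely Green's
  formula has no boundary term for finitely supported \<open>u\<close>.\<close>

lemma adjoint_eigenspace_minimal_jacobi:
  "adjoint_eigenspace (minimal_jacobi a b) z
     = {v \<in> ell2. \<forall>n. jacobi_matrix a b v n = z * v n}"
proof (intro set_eqI iffI)
  fix v
  assume "v \<in> adjoint_eigenspace (minimal_jacobi a b) z"
  then have v: "v \<in> ell2"
    and eq: "\<And>u. finite {n. u n \<noteq> 0} \<Longrightarrow>
      ell2_inner (jacobi_matrix a b u) v = ell2_inner u (seq_scale z v)"
    unfolding adjoint_eigenspace_def ell2_adjoint_def minimal_jacobi_def by auto
  have "jacobi_matrix a b v m = z * v m" for m
  proof -
    define u :: "nat \<Rightarrow> complex" where "u = (\<lambda>n. if n = m then 1 else 0)"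
    have "ell2_inner u (seq_scale z v) = (\<Sum>n<m+1. u n * cnj (seq_scale z v n))"
      by (rule ell2_inner_finite_support) (simp add: u_def)
    also have "\<dots> = cnj (z * v m)"
      by (simp add: u_def seq_scale_def if_distrib[of "\<lambda>x. x * _"] cong: if_cong)
    finally have rhs: "ell2_inner u (seq_scale z v) = cnj (z * v m)" .
    \<comment> \<open>The image of the unit vector at \<open>m\<close> reaches up to index
      \<open>m + 1\<close>. Summing that far puts the Wronskian at indices \<open>m + 1\<close> and
      \<open>m + 2\<close>, where \<open>u\<close> vanishes.\<close>
    have "ell2_inner (jacobi_matrix a b u) v
        = (\<Sum>n<Suc (Suc m). jacobi_matrix a b u n * cnj (v n))"
      by (rule ell2_inner_finite_support) (auto simp: jacobi_matrix_def u_def)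
    also have "\<dots> = (\<Sum>n<Suc (Suc m). u n * jacobi_matrix a b (\<lambda>i. cnj (v i)) n)"
      unfolding jacobi_matrix_lagrange by (simp add: u_def)
    also have "\<dots> = cnj (jacobi_matrix a b v m)"
      by (simp add: u_def cnj_jacobi_matrix if_distrib[of "\<lambda>x. x * _"] cong: if_cong)
    finally have "cnj (jacobi_matrix a b v m) = cnj (z * v m)"
      using eq[of u] rhs by (simp add: u_def)
    then show ?thesis by (simp only: complex_cnj_cancel_iff)
  qed
  with v show "v \<in> {v \<in> ell2. \<forall>n. jacobi_matrix a b v n = z * v n}" by blast
next
  fix v
  assume "v \<in> {v \<in> ell2. \<forall>n. jacobi_matrix a b v n = z * v n}"
  then have v: "v \<in> ell2" and Jv: "\<And>n. jacobi_matrix a b v n = z * v n" by auto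
  have "ell2_inner (jacobi_matrix a b u) v = ell2_inner u (seq_scale z v)"
    if fin: "finite {n. u n \<noteq> 0}" for u
  proof -
    obtain N where N: "\<And>n. n \<ge> N \<Longrightarrow> u n = 0"
      using fin unfolding finite_nat_set_iff_bounded by (auto simp: not_less[symmetric])
    \<comment> \<open>The matrix enlarges the support by at most one index, hence
      \<open>Suc N\<close>; the boundary term contains only \<open>u N\<close> and
      \<open>u (Suc N)\<close>, both zero.\<close>
    have "ell2_inner (jacobi_matrix a b u) v
        = (\<Sum>n<Suc N. jacobi_matrix a b u n * cnj (v n))"
      by (rule ell2_inner_finite_support) (use N in \<open>simp add: jacobi_matrix_def\<close>)
    also have "\<dots> = (\<Sum>n<Suc N. u n * jacobi_matrix a b (\<lambda>i. cnj (v i)) n)"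
      unfolding jacobi_matrix_lagrange by (simp add: N)
    also have "\<dots> = (\<Sum>n<Suc N. u n * cnj (seq_scale z v n))"
      by (simp add: cnj_jacobi_matrix[symmetric] Jv seq_scale_def)
    also have "\<dots> = ell2_inner u (seq_scale z v)"
      by (rule ell2_inner_finite_support[symmetric]) (use N in simp)
    finally show ?thesis .
  qed
  with v show "v \<in> adjoint_eigenspace (minimal_jacobi a b) z"
    unfolding adjoint_eigenspace_def ell2_adjoint_def minimal_jacobi_def
    by (auto simp: seq_scale_ell2)
qed

section \<open>Orthogonal polynomials and the dimension of the eigenspaces\<close>

text \<open>These are the orthogonal polynomials of the first kind P_n(z) of the Jacobi matrix,
  normalised by P_0 = 1.\<close>

fun jacobi_poly :: "(nat \<Rightarrow> real) \<Rightarrow> (nat \<Rightarrow> real) \<Rightarrow> complex \<Rightarrow> nat \<Rightarrow> complex" where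
  "jacobi_poly a b z 0 = 1"
| "jacobi_poly a b z (Suc 0) = (z - of_real (b 0)) / of_real (a 0)"
| "jacobi_poly a b z (Suc (Suc n)) =
    ((z - of_real (b (Suc n))) * jacobi_poly a b z (Suc n) - of_real (a n) * jacobi_poly a b z n)
      / of_real (a (Suc n))"

text \<open>As \<open>a n\<close> is nonzero, row \<open>n\<close> can be solved for the entry at
  \<open>n + 1\<close>, so the entry at 0 determines an eigenvector. Naming the scalar as
  \<open>v 0\<close> avoids an existential quantifier.\<close>

lemma jacobi_matrix_eigenvector_iff:
  assumes pos: "\<And>n. a n > 0"
  shows "(\<forall>n. jacobi_matrix a b v n = z * v n) \<longleftrightarrow> v = seq_scale (v 0) (jacobi_poly a b z)"
proof
  assume eq: "\<forall>n. jacobi_matrix a b v n = z * v n"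
  have nz: "complex_of_real (a n) \<noteq> 0" for n
    using pos[of n] by simp
  have "v n = v 0 * jacobi_poly a b z n" for n
  proof (induction n rule: induct_nat_012)
    case 0
    show ?case by simp
  next
    case 1
    have "of_real (a 0) * v (Suc 0) = (z - of_real (b 0)) * v 0"
      using eq[rule_format, of 0] by (simp add: jacobi_matrix_def algebra_simps)
    then show ?case
      using nz[of 0] by (simp add: eq_divide_eq mult.commute)
  next
    case (ge2 n)
    have "of_real (a (Suc n)) * v (Suc (Suc n))
        = (z - of_real (b (Suc n))) * v (Suc n) - of_real (a n) * v n"
      using eq[rule_format, of "Suc n"] by (simp add: jacobi_matrix_def algebra_simps)
    then have "v (Suc (Suc n))
        = ((z - of_real (b (Suc n))) * v (Suc n) - of_real (a n) * v n) / of_real (a (Suc n))"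
      using nz[of "Suc n"] by (simp add: eq_divide_eq mult.commute)
    then show ?case
      unfolding ge2 by (simp add: right_diff_distrib diff_divide_distrib mult_ac)
  qed
  then show "v = seq_scale (v 0) (jacobi_poly a b z)"
    unfolding seq_scale_def by (rule ext)
next
  assume v: "v = seq_scale (v 0) (jacobi_poly a b z)"
  have nz: "complex_of_real (a n) \<noteq> 0" for n
    using pos[of n] by simp
  have poly: "jacobi_matrix a b (jacobi_poly a b z) n = z * jacobi_poly a b z n" for n
    using nz by (cases n) (simp_all add: jacobi_matrix_def field_simps)
  have "jacobi_matrix a b (seq_scale c p) n = c * jacobi_matrix a b p n" for c p n
    by (simp add: jacobi_matrix_def seq_scale_def algebra_simps)
  then have "jacobi_matrix a b (seq_scale c (jacobi_poly a b z)) n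
      = z * seq_scale c (jacobi_poly a b z) n" for c n
    by (simp only: poly) (simp add: seq_scale_def)
  then show "\<forall>n. jacobi_matrix a b v n = z * v n"
    using v by metis
qed

interpretation seqs: vector_space seq_scale
  by (rule vector_space_seq_scale)

lemma dim_jacobi_eigenvectors:
  assumes "\<And>n. a n > 0"
  shows "seqs.dim {v. \<forall>n. jacobi_matrix a b v n = z * v n} = 1"
proof -
  let ?P = "jacobi_poly a b z"
  \<comment> \<open>Because P_0 = 1, the entry at 0 of a multiple of P is its scalar; hence every
    multiple satisfies the fixed-point form of the criterion.\<close>
  have "seq_scale c ?P = seq_scale (seq_scale c ?P 0) ?P" for c
    by (simp add: seq_scale_def)
  then have "{v. \<forall>n. jacobi_matrix a b v n = z * v n} = range (\<lambda>c. seq_scale c ?P)"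
    unfolding jacobi_matrix_eigenvector_iff[where a = a, OF assms] by blast
  also have "\<dots> = seqs.span {?P}"
    by (simp add: seqs.span_singleton)
  finally have "seqs.dim {v. \<forall>n. jacobi_matrix a b v n = z * v n} = seqs.dim {?P}"
    by (simp add: seqs.dim_span)
  moreover have "?P \<noteq> 0"
    using jacobi_poly.simps(1)[of a b z] by (metis zero_fun_apply zero_neq_one)
  ultimately show ?thesis
    by (simp add: seqs.dim_eq_card_independent)
qed

theorem corollary4p2:
  fixes a b :: "nat \<Rightarrow> real" and \<beta>_inf :: real
  assumes "\<And>n. a n > 0"
    and "summable (\<lambda>n. inverse (a n))"
    and "jacobi_beta a b \<longlonglongrightarrow> \<beta>_inf"
    and "\<bar>\<beta>_inf\<bar> < 1"
    and "summable (\<lambda>n. \<bar>jacobi_k a n - 1\<bar>)"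
    and "summable (\<lambda>n. \<bar>jacobi_beta a b (n + 1) - jacobi_beta a b n\<bar>)"
  shows "(\<forall>z F. jacobi_solution a b z F \<longrightarrow> (\<lambda>n. F (int n)) \<in> ell2)
    \<and> deficiency_indices (minimal_jacobi a b) = (1, 1)"
proof -
  have ell2: "(\<lambda>n. F (int n)) \<in> ell2" if "jacobi_solution a b z F" for z F
    using jacobi_solution_ell2[where a = a and b = b, OF assms that] .
  have eigenvector_ell2: "v \<in> ell2" if "\<forall>n. jacobi_matrix a b v n = z * v n" for v z
    using ell2[OF jacobi_solution_extension[of a b v z]] that by simp
  \<comment> \<open>Membership in \<open>ell2\<close> is automatic for formal eigenvectors, so the
    eigenspace of the adjoint is the full line of multiples of P for every \<open>z\<close>, in
    particular for \<i> and -\<i>.\<close>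
  have "adjoint_eigenspace (minimal_jacobi a b) z
      = {v. \<forall>n. jacobi_matrix a b v n = z * v n}" for z
    unfolding adjoint_eigenspace_minimal_jacobi by (auto intro: eigenvector_ell2)
  then have "seqs.dim (adjoint_eigenspace (minimal_jacobi a b) z) = 1" for z
    by (simp only: dim_jacobi_eigenvectors[where a = a, OF assms(1)])
  then have "deficiency_indices (minimal_jacobi a b) = (1, 1)"
    unfolding deficiency_indices_def by (simp only:)
  with ell2 show ?thesis by blast
qed

end
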